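(* For every $n\ge 2$ and every symmetric matrix $A\in\mathbb{R}^{n\times n}$, the algorithm COPOMATRIX with input $A$ terminates, and its output is correct: it returns "$A$ is copositive" if $A$ is copositive, and it returns "$A$ is not copositive" if $A$ is not copositive.
   Context: A real symmetric $n\times n$ matrix $A$ is copositive if $X^TAX\ge 0$ for all $X\in\mathbb{R}^n$ with nonnegative entries. Standard simplex: $\Delta_m=\{y\in\mathbb{R}^m: y_1+\cdots+y_m=1,\ y_i\ge 0\}$, with vertices $e_1,\ldots,e_m$; $M_{i,j}=(e_i+e_j)/2$. Polytope notation: for distinct $a_1,\ldots,a_s,b_1,\ldots,b_t\in\{1,\ldots,m\}$ with $s\ge 0$, $t\ge 1$, $[[a_1,\ldots,a_s],[b_1,\ldots,b_t]]_m$ is the set of $y\in\Delta_m$ with $y_{a_1}+\cdots+y_{a_s}-y_{b_1}-\cdots-y_{b_t}\le 0$ and $(y_{a_1},\ldots,y_{a_s},y_{b_1},\ldots,y_{b_t})^T\in\Delta_{s+t}$ (so all other coordinates vanish). Its vertices are $e_{b_1},\ldots,e_{b_t}$ and $M_{a_i,b_j}$ ($1\le i\le s$, $1\le j\le t$), and it is a simplex iff $s=0$ or $t=1$ (for $s=0$, $t=1$ it is the single point $e_{b_1}$). Algorithm Vmatrix (simplicial subdivision of $[[a_1,\ldots,a_s],[b_1,\ldots,b_t]]_m$): if the polytope is a simplex, return it. Otherwise replace it by $\mathrm{conv}\{M_{a_1,b_1},[[a_2,\ldots,a_s],[b_1,\ldots,b_t]]_m\}$ and $\mathrm{conv}\{M_{a_1,b_1},[[a_1,\ldots,a_s],[b_2,\ldots,b_t]]_m\}$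 and repeat the procedure on the bracketed polytopes (keeping the accumulated midpoints as additional vertices) until all pieces are simplices. The output is the finite list of resulting simplices. Operator Proj: let $A=\begin{bmatrix}\alpha_{11}&\alpha^T\\ \alpha&A_2\end{bmatrix}$ be symmetric of order $n\ge2$, with $\alpha=(\alpha_{12},\ldots,\alpha_{1n})^T$. Let $D=\mathrm{diag}(d_2,\ldots,d_n)$ with $d_i=1$ if $\alpha_{1i}=0$ and $d_i=1/|\alpha_{1i}|$ otherwise; let $\widehat{\alpha}=(\beta_1,\ldots,\beta_{n-1})^T=(\mathrm{sign}(\alpha_{12}),\ldots,\mathrm{sign}(\alpha_{1n}))^T$ and $B=\alpha_{11}DA_2D-\widehat{\alpha}\widehat{\alpha}^T$. - If all $\beta_i\ge 0$, then $\mathrm{Proj}(A)=\{DA_2D\}$. - If at least one $\beta_i=-1$, then $\mathrm{Proj}(A)=\{DA_2D,\ W_1^TBW_1,\ldots,W_p^TBW_p\}$, where $W_1,\ldots,W_p$ are determined as follows. Let $a_1,\ldots,a_s$, $b_1,\ldots,b_t$, $c_1,\ldots,c_r$ be the indices in $\{1,\ldots,n-1\}$ at which $\beta$ equals $1$, $-1$, $0$ respectively. Let $S_1,\ldots,S_p$ be the simplices output by Vmatrix for $S^-=[[a_1,\ldots,a_s],[b_1,\ldots,b_t]]_{n-1}$. Then $W_i$ is the $(n-1)\times(n-1)$ matrix whose columns are $e_{c_1},\ldots,e_{c_r}$ together with the vertices of $S_i$. Thus the simplices spanned by the columns of the $W_i$ form a simplicial subdivision of $\widehat{T}^-=\{y\in\Delta_{n-1}:\widehat{\alpha}^Ty\le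 0\}=\mathrm{conv}\{e_{c_1},\ldots,e_{c_r},S^-\}$. Algorithm COPOMATRIX (input: symmetric $A\in\mathbb{R}^{n\times n}$, $n\ge 2$): C1: Let $F:=\{A\}$. C2: Repeat the following steps for the set $F$. C21: If $F$ is empty, return "$A$ is copositive". C22: Check the $(1,1)$ entry of every matrix in $F$. If at least one of them is negative, return "$A$ is not copositive". C23: Compute $P:=\bigcup_{K\in F}\mathrm{Proj}(K)$, set $F:=P\setminus\{\text{the matrices of } P \text{ that are entrywise nonnegative}\}$, and go to C21. Convention for order-one matrices: should $F$ contain $1\times1$ matrices $[\kappa]$ after step C23, they have $\kappa<0$ and the algorithm stops at C22. *)

theory Defs
  imports Complex_Main "Jordan_Normal_Form.Matrix"
begin

text \<open>
  The algorithm changes the order of the matrices it works on, so vectors and matrices carry their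
  dimension as a value. Indices start at 0: the distinguished $(1,1)$ entry is \<open>A $$ (0, 0)\<close>, and the
  coordinates of the vectors of dimension $m$ are numbered $0, \ldots, m - 1$.
\<close>

definition symmetric_mat :: "real mat \<Rightarrow> bool" where
  "symmetric_mat A \<longleftrightarrow> square_mat A \<and> transpose_mat A = A"

definition copositive :: "real mat \<Rightarrow> bool" where
  "copositive A \<longleftrightarrow> symmetric_mat A \<and>
     (\<forall>x \<in> carrier_vec (dim_row A). (\<forall>i < dim_row A. 0 \<le> x $ i) \<longrightarrow> 0 \<le> x \<bullet> (A *\<^sub>v x))"

definition entrywise_nonneg :: "real mat \<Rightarrow> bool" where
  "entrywise_nonneg A \<longleftrightarrow> (\<forall>i < dim_row A. \<forall>j < dim_col A. 0 \<le> A $$ (i, j))"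


definition midpoint_vec :: "nat \<Rightarrow> nat \<Rightarrow> nat \<Rightarrow> real vec" where
  "midpoint_vec m i j = (1 / 2) \<cdot>\<^sub>v (unit_vec m i + unit_vec m j)"

text \<open>
  Polytopes are represented by lists of their vertices. The polytope $[[as],[bs]]_m$ has the vertices
  $e_b$ and $M_{a,b}$; it is a simplex iff \<open>as\<close> is empty or \<open>bs\<close> has length one.
\<close>

definition polytope_vertices :: "nat \<Rightarrow> nat list \<Rightarrow> nat list \<Rightarrow> real vec list" where
  "polytope_vertices m as bs = map (unit_vec m) bs @ [midpoint_vec m a b. a \<leftarrow> as, b \<leftarrow> bs]"

text \<open>
  The result is the list of simplices, each given by its vertices. The case of an empty second list
  is only there to make the function total; it is never used.
\<close>

fun Vmatrix :: "nat \<Rightarrow> nat list \<Rightarrow> nat list \<Rightarrow> real vec list list" where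
  "Vmatrix m as [] = []"
| "Vmatrix m [] (b # bs) = [polytope_vertices m [] (b # bs)]"
| "Vmatrix m (a # as) [b] = [polytope_vertices m (a # as) [b]]"
| "Vmatrix m (a # as) (b # b' # bs) =
     map (\<lambda>S. midpoint_vec m a b # S) (Vmatrix m as (b # b' # bs)) @
     map (\<lambda>S. midpoint_vec m a b # S) (Vmatrix m (a # as) (b' # bs))"


definition alpha_vec :: "real mat \<Rightarrow> real vec" where
  "alpha_vec A = vec (dim_row A - 1) (\<lambda>i. A $$ (0, Suc i))"

definition trailing_block :: "real mat \<Rightarrow> real mat" where
  "trailing_block A = mat (dim_row A - 1) (dim_row A - 1) (\<lambda>(i, j). A $$ (Suc i, Suc j))"

definition scaling_mat :: "real mat \<Rightarrow> real mat" where
  "scaling_mat A = mat_diag (dim_row A - 1)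
     (\<lambda>i. if alpha_vec A $ i = 0 then 1 else 1 / \<bar>alpha_vec A $ i\<bar>)"

definition sign_vec :: "real mat \<Rightarrow> real vec" where
  "sign_vec A = map_vec sgn (alpha_vec A)"

definition scaled_block :: "real mat \<Rightarrow> real mat" where
  "scaled_block A = scaling_mat A * trailing_block A * scaling_mat A"

definition B_mat :: "real mat \<Rightarrow> real mat" where
  "B_mat A = (A $$ (0, 0)) \<cdot>\<^sub>m scaled_block A -
     mat (dim_row A - 1) (dim_row A - 1) (\<lambda>(i, j). sign_vec A $ i * sign_vec A $ j)"

definition enumerates :: "nat list \<Rightarrow> nat set \<Rightarrow> bool" where
  "enumerates xs X \<longleftrightarrow> distinct xs \<and> set xs = X"

definition is_W :: "nat \<Rightarrow> nat list \<Rightarrow> real vec list \<Rightarrow> real mat \<Rightarrow> bool" where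
  "is_W m cs S W \<longleftrightarrow> W \<in> carrier_mat m m \<and> mset (cols W) = mset (map (unit_vec m) cs @ S)"

text \<open>
  \<open>is_Proj A P\<close> says that \<open>P\<close> is a value of $\mathrm{Proj}(A)$. It is a relation because the order in
  which the indices $a_i$, $b_j$ are listed and the order of the columns of the matrices $W_i$ are
  left open; every choice is allowed.
\<close>

inductive is_Proj :: "real mat \<Rightarrow> real mat set \<Rightarrow> bool" where
  no_negative_sign:
  "\<lbrakk> A \<in> carrier_mat n n; 2 \<le> n; symmetric_mat A;
     \<forall>i < n - 1. 0 \<le> sign_vec A $ i \<rbrakk>
   \<Longrightarrow> is_Proj A {scaled_block A}"
| negative_sign:
  "\<lbrakk> A \<in> carrier_mat n n; 2 \<le> n; symmetric_mat A;
     \<exists>i < n - 1. sign_vec A $ i = -1;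
     enumerates as {i. i < n - 1 \<and> sign_vec A $ i = 1};
     enumerates bs {i. i < n - 1 \<and> sign_vec A $ i = -1};
     enumerates cs {i. i < n - 1 \<and> sign_vec A $ i = 0};
     list_all2 (is_W (n - 1) cs) (Vmatrix (n - 1) as bs) Ws \<rbrakk>
   \<Longrightarrow> is_Proj A (insert (scaled_block A) {transpose_mat W * B_mat A * W | W. W \<in> set Ws})"


datatype verdict = Is_Copositive | Is_Not_Copositive

datatype copo_state = Running "real mat set" | Returned verdict

inductive copomatrix_step :: "copo_state \<Rightarrow> copo_state \<Rightarrow> bool" where
  C21: "copomatrix_step (Running {}) (Returned Is_Copositive)"
| C22: "\<exists>K \<in> F. K $$ (0, 0) < 0 \<Longrightarrow> copomatrix_step (Running F) (Returned Is_Not_Copositive)"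
| C23:
  "\<lbrakk> F \<noteq> {}; \<forall>K \<in> F. \<not> K $$ (0, 0) < 0;
     \<forall>K \<in> F. is_Proj K (Pr K); P = (\<Union>K \<in> F. Pr K) \<rbrakk>
   \<Longrightarrow> copomatrix_step (Running F) (Running (P - {K \<in> P. entrywise_nonneg K}))"

definition copomatrix_terminates :: "real mat \<Rightarrow> bool" where
  "copomatrix_terminates A \<longleftrightarrow>
     \<not> (\<exists>\<sigma>. \<sigma> 0 = Running {A} \<and> (\<forall>k::nat. copomatrix_step (\<sigma> k) (\<sigma> (Suc k))))"

text \<open>
  Some execution returns \<open>v\<close>, and every execution that cannot be continued has returned \<open>v\<close>. In
  particular none gets stuck in a running state, for instance by having to apply Proj to a matrix
  outside its domain.
\<close>

definition copomatrix_outputs :: "real mat \<Rightarrow> verdict \<Rightarrow> bool" where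
  "copomatrix_outputs A v \<longleftrightarrow>
     copomatrix_step\<^sup>*\<^sup>* (Running {A}) (Returned v) \<and>
     (\<forall>s. copomatrix_step\<^sup>*\<^sup>* (Running {A}) s \<and> \<not> (\<exists>s'. copomatrix_step s s') \<longrightarrow> s = Returned v)"

end

theory Submission
  imports Defs
begin

text \<open>
  Write \<open>c\<close> for the corner, \<open>\<alpha>\<close> for the rest of the first row and \<open>Q\<close> for the quadratic form of the
  trailing block. Minimising \<open>c t\<^sup>2 + 2 t (\<alpha> \<bullet> y) + Q y\<close> over \<open>t \<ge> 0\<close> shows that, when \<open>c \<ge> 0\<close>, the matrix
  is copositive iff \<open>Q\<close> is nonnegative on the orthant and \<open>c Q y \<ge> (\<alpha> \<bullet> y)\<^sup>2\<close> on its part where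
  \<open>\<alpha> \<bullet> y \<le> 0\<close>; the case \<open>c = 0\<close> needs no separate treatment. After rescaling, that part is the union
  of the cones over the simplices of the subdivision, so the second condition says that all
  \<open>W\<^sup>T B W\<close> are copositive. Hence every pass of the loop preserves the joint copositivity of the
  matrices in \<open>F\<close>, while their order drops by one.
\<close>

subsection \<open>Simplicial cones\<close>

text \<open>Cones replace simplices, so no normalisation to coordinate sum one is needed. Adding one
  ray at a time matches arguments that peel off one vertex; a coefficient vector is recovered only
  once the generators are columns of a matrix.\<close>

inductive in_cone :: "nat \<Rightarrow> real vec set \<Rightarrow> real vec \<Rightarrow> bool" for m X where
  zero: "in_cone m X (0\<^sub>v m)"
| add: "in_cone m X z \<Longrightarrow> v \<in> X \<Longrightarrow> 0 \<le> c \<Longrightarrow> in_cone m X (z + c \<cdot>\<^sub>v v)"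

lemma in_cone_mono:
  assumes "in_cone m X z" "X \<subseteq> Y"
  shows "in_cone m Y z"
  using assms by (induction rule: in_cone.induct) (auto intro: in_cone.intros)

lemma in_cone_imp_mult_mat_vec:
  assumes W: "W \<in> carrier_mat m k" and "in_cone m (set (cols W)) z"
  shows "\<exists>u \<in> carrier_vec k. (\<forall>i < k. 0 \<le> u $ i) \<and> z = W *\<^sub>v u"
  using assms(2)
proof (induction rule: in_cone.induct)
  case zero
  have "W *\<^sub>v 0\<^sub>v k = 0\<^sub>v m"
    using W by (intro eq_vecI) auto
  then show ?case by (intro bexI[of _ "0\<^sub>v k"]) auto
next
  case (add z v c)
  then obtain u where u: "u \<in> carrier_vec k" "\<forall>i < k. 0 \<le> u $ i" "z = W *\<^sub>v u" by blast
  obtain j where j: "j < k" "v = col W j"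
    using add.hyps W by (auto simp: cols_def)
  have "W *\<^sub>v unit_vec k j = v"
    using W j by (intro eq_vecI) auto
  then have "z + c \<cdot>\<^sub>v v = W *\<^sub>v (u + c \<cdot>\<^sub>v unit_vec k j)"
    using W u j by (simp add: mult_add_distrib_mat_vec mult_mat_vec[OF W])
  moreover have "\<forall>i < k. 0 \<le> (u + c \<cdot>\<^sub>v unit_vec k j) $ i"
    using u j add.hyps by auto
  ultimately show ?case using u by (intro bexI[of _ "u + c \<cdot>\<^sub>v unit_vec k j"]) auto
qed

text \<open>Nonnegative coordinates can be restored one at a time as multiples of unit vectors. This
  serves both the simplices without midpoints (with \<open>X\<close> empty) and the coordinates of
  sign zero, on which \<open>Vmatrix\<close> does not act.\<close>

lemma in_cone_add_units:
  assumes "in_cone m X (vec m (\<lambda>i. if i \<in> set is then 0 else z $ i))"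
    and "distinct is" "z \<in> carrier_vec m" "\<forall>i < m. 0 \<le> z $ i" "set is \<subseteq> {..<m}"
  shows "in_cone m (X \<union> unit_vec m ` set is) z"
  using assms
proof (induction "is" arbitrary: z)
  case Nil
  have "vec m (\<lambda>i. z $ i) = z" using Nil by auto
  with Nil show ?case by simp
next
  case (Cons c "is")
  let ?z = "vec m (\<lambda>i. if i = c then 0 else z $ i)"
  have eq: "vec m (\<lambda>i. if i \<in> set is then 0 else ?z $ i)
      = vec m (\<lambda>i. if i \<in> set (c # is) then 0 else z $ i)"
    by auto
  have "in_cone m (X \<union> unit_vec m ` set is) ?z"
    using Cons.prems by (intro Cons.IH) (simp_all add: eq)
  then have "in_cone m (X \<union> unit_vec m ` set (c # is)) (?z + z $ c \<cdot>\<^sub>v unit_vec m c)"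
    using Cons.prems by (intro in_cone.add) (auto elim: in_cone_mono)
  moreover have "?z + z $ c \<cdot>\<^sub>v unit_vec m c = z"
    using Cons.prems by auto
  ultimately show ?case by simp
qed

lemma in_cone_midpoint:
  assumes "in_cone m X (vec m (\<lambda>i. z $ i - (if i = a \<or> i = b then c else 0)))"
    and "midpoint_vec m a b \<in> X" "a \<noteq> b" "z \<in> carrier_vec m" "a < m" "b < m" "0 \<le> c"
  shows "in_cone m X z"
proof -
  \<comment> \<open>The midpoint has weight one half in each of its two coordinates, so removing
    \<open>c\<close> from both costs \<open>2 * c\<close> times the midpoint.\<close>
  have "in_cone m X (vec m (\<lambda>i. z $ i - (if i = a \<or> i = b then c else 0))
      + (2 * c) \<cdot>\<^sub>v midpoint_vec m a b)"
    using assms by (intro in_cone.add) auto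
  moreover have "vec m (\<lambda>i. z $ i - (if i = a \<or> i = b then c else 0))
      + (2 * c) \<cdot>\<^sub>v midpoint_vec m a b = z"
    using assms by (intro eq_vecI) (auto simp: midpoint_vec_def)
  ultimately show ?thesis by simp
qed

text \<open>Each coordinate \<open>a\<close> is cancelled against \<open>b\<close> by a multiple of
  their midpoint. The bound on the sum says that \<open>b\<close> has enough mass for all of them;
  what is left over is a multiple of the unit vector at \<open>b\<close>.\<close>

lemma in_cone_single:
  assumes "distinct (as @ [b])" "set as \<union> {b} \<subseteq> {..<m}"
    and "z \<in> carrier_vec m" "\<forall>i < m. 0 \<le> z $ i"
    and "\<forall>i < m. i \<notin> set as \<union> {b} \<longrightarrow> z $ i = 0"
    and "sum_list (map (($) z) as) \<le> z $ b"
  shows "in_cone m (insert (unit_vec m b) ((\<lambda>a. midpoint_vec m a b) ` set as)) z"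
  using assms
proof (induction as arbitrary: z)
  case Nil
  have "vec m (\<lambda>i. if i \<in> set [b] then 0 else z $ i) = 0\<^sub>v m"
    using Nil by auto
  with in_cone_add_units[of m "{}" "[b]" z] Nil show ?case
    by (auto intro: in_cone.zero)
next
  case (Cons a as)
  let ?z = "vec m (\<lambda>i. z $ i - (if i = a \<or> i = b then z $ a else 0))"
  have m: "map (($) ?z) as = map (($) z) as"
    using Cons.prems by (auto intro!: map_cong)
  have nn: "0 \<le> sum_list (map (($) z) as)"
    using Cons.prems by (intro sum_list_nonneg) auto
  have "in_cone m (insert (unit_vec m b) ((\<lambda>a. midpoint_vec m a b) ` set as)) ?z"
    using Cons.prems nn by (intro Cons.IH) (auto simp: m simp del: map_eq_conv)
  then have "in_cone m (insert (unit_vec m b) ((\<lambda>a. midpoint_vec m a b) ` set (a # as))) ?z"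
    by (rule in_cone_mono) auto
  then show ?case
    by (rule in_cone_midpoint) (use Cons.prems in auto)
qed

subsection \<open>The simplicial subdivision\<close>

text \<open>Each recursive step drops one index and adds one vertex. This count is what makes the
  matrices \<open>W\<close> square.\<close>

lemma length_Vmatrix:
  "S \<in> set (Vmatrix m as bs) \<Longrightarrow> length S = length as + length bs"
  by (induction m as bs arbitrary: S rule: Vmatrix.induct)
     (auto simp: polytope_vertices_def length_concat o_def sum_list_triv)

lemma Vmatrix_vertices:
  assumes "S \<in> set (Vmatrix m as bs)" "v \<in> set S"
  shows "v \<in> unit_vec m ` set bs \<union> {midpoint_vec m a b | a b. a \<in> set as \<and> b \<in> set bs}"
  using assms
  by (induction m as bs arbitrary: S v rule: Vmatrix.induct)
     (fastforce simp: polytope_vertices_def)+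

text \<open>The recursion is followed along \<open>z\<close>. Subtracting the smaller of
  \<open>z $ a\<close> and \<open>z $ b\<close> from both coordinates removes a multiple of the
  midpoint, keeps the difference of the two sums, and makes one of the two coordinates zero. The
  remainder therefore belongs to the branch that drops this index.\<close>

lemma Vmatrix_covers:
  assumes "bs \<noteq> []" "distinct (as @ bs)" "set as \<union> set bs \<subseteq> {..<m}"
    and "z \<in> carrier_vec m" "\<forall>i < m. 0 \<le> z $ i"
    and "\<forall>i < m. i \<notin> set as \<union> set bs \<longrightarrow> z $ i = 0"
    and "sum_list (map (($) z) as) \<le> sum_list (map (($) z) bs)"
  shows "\<exists>S \<in> set (Vmatrix m as bs). in_cone m (set S) z"
  using assms
proof (induction m as bs arbitrary: z rule: Vmatrix.induct)
  case (1 m as)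
  then show ?case by simp
next
  case (2 m b bs)
  have "vec m (\<lambda>i. if i \<in> set (b # bs) then 0 else z $ i) = 0\<^sub>v m"
    using 2 by auto
  with in_cone_add_units[of m "{}" "b # bs" z] 2 show ?case
    by (auto intro: in_cone.zero simp: polytope_vertices_def)
next
  case (3 m a as b)
  have "in_cone m (insert (unit_vec m b) ((\<lambda>a. midpoint_vec m a b) ` set (a # as))) z"
    using 3 by (intro in_cone_single) auto
  then show ?case
    by (auto simp: polytope_vertices_def elim!: in_cone_mono)
next
  case (4 m a as b b' bs)
  define c where "c = min (z $ a) (z $ b)"
  define y where "y = vec m (\<lambda>i. z $ i - (if i = a \<or> i = b then c else 0))"
  have ab: "a < m" "b < m" "a \<noteq> b" "0 \<le> c"
    using 4(3-) by (auto simp: c_def)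
  have y: "y \<in> carrier_vec m" "\<forall>i < m. 0 \<le> y $ i"
    "\<forall>i < m. i \<notin> set (a # as) \<union> set (b # b' # bs) \<longrightarrow> y $ i = 0"
    using 4(3-) by (auto simp: y_def c_def)
  have y_as: "map (($) y) as = map (($) z) as" "map (($) y) bs = map (($) z) bs" "y $ b' = z $ b'"
    using 4(3-) by (auto simp: y_def)
  have y_ab: "y $ a = z $ a - c" "y $ b = z $ b - c"
    using ab by (auto simp: y_def)
  have "\<exists>S. midpoint_vec m a b # S \<in> set (Vmatrix m (a # as) (b # b' # bs)) \<and> in_cone m (set S) y"
  proof (cases "z $ a \<le> z $ b")
    case True
    then have 0: "y $ a = 0" using y_ab by (simp add: c_def)
    have "\<exists>S \<in> set (Vmatrix m as (b # b' # bs)). in_cone m (set S) y"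
    proof (rule 4(1))
      show "\<forall>i < m. i \<notin> set as \<union> set (b # b' # bs) \<longrightarrow> y $ i = 0"
        using y(3) 0 by auto
      show "sum_list (map (($) y) as) \<le> sum_list (map (($) y) (b # b' # bs))"
        using 4(9) 0 y_ab by (simp add: y_as del: map_eq_conv)
    qed (use 4(3-) y in auto)
    then show ?thesis by auto
  next
    case False
    then have 0: "y $ b = 0" using y_ab by (simp add: c_def)
    have "\<exists>S \<in> set (Vmatrix m (a # as) (b' # bs)). in_cone m (set S) y"
    proof (rule 4(2))
      show "\<forall>i < m. i \<notin> set (a # as) \<union> set (b' # bs) \<longrightarrow> y $ i = 0"
        using y(3) 0 by auto
      show "sum_list (map (($) y) (a # as)) \<le> sum_list (map (($) y) (b' # bs))"
        using 4(9) 0 y_ab by (simp add: y_as del: map_eq_conv)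
    qed (use 4(3-) y in auto)
    then show ?thesis by auto
  qed
  then obtain S where S: "midpoint_vec m a b # S \<in> set (Vmatrix m (a # as) (b # b' # bs))"
    "in_cone m (set S) y" by blast
  have "in_cone m (set (midpoint_vec m a b # S)) y"
    using S(2) by (rule in_cone_mono) auto
  then have "in_cone m (set (midpoint_vec m a b # S)) z"
    unfolding y_def by (rule in_cone_midpoint) (use ab 4(3-) in auto)
  with S(1) show ?case by blast
qed

lemma sum_sign_partition:
  fixes z :: "nat \<Rightarrow> real"
  assumes "enumerates as {i. i < m \<and> s i = 1}" "enumerates bs {i. i < m \<and> s i = (-1::real)}"
    and "\<forall>i < m. s i \<in> {-1, 0, 1}"
  shows "(\<Sum>i<m. s i * z i) = sum_list (map z as) - sum_list (map z bs)"
proof -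
  have "(\<Sum>i<m. s i * z i) = (\<Sum>i<m. (if s i = 1 then z i else 0) - (if s i = -1 then z i else 0))"
    using assms(3) by (intro sum.cong) auto
  also have "\<dots> = (\<Sum>i \<in> {i. i < m \<and> s i = 1}. z i) - (\<Sum>i \<in> {i. i < m \<and> s i = -1}. z i)"
    by (simp add: sum_subtractf sum.If_cases Int_def)
  also have "\<dots> = sum_list (map z as) - sum_list (map z bs)"
    using assms(1,2) by (auto simp: enumerates_def sum_list_distinct_conv_sum_set)
  finally show ?thesis .
qed

subsection \<open>Quadratic forms\<close>

definition qf :: "real mat \<Rightarrow> real vec \<Rightarrow> real" where
  "qf A x = x \<bullet> (A *\<^sub>v x)"

lemma qf_sum:
  assumes "A \<in> carrier_mat n n" "x \<in> carrier_vec n"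
  shows "qf A x = (\<Sum>i<n. \<Sum>j<n. x $ i * A $$ (i, j) * x $ j)"
  using assms
  by (auto simp: qf_def scalar_prod_def sum_distrib_left atLeast0LessThan algebra_simps
      intro!: sum.cong)

lemma qf_congruence:
  assumes B: "B \<in> carrier_mat n n" and W: "W \<in> carrier_mat n k" and u: "u \<in> carrier_vec k"
  shows "qf (transpose_mat W * B * W) u = qf B (W *\<^sub>v u)"
proof -
  have Wt: "transpose_mat W \<in> carrier_mat k n" and Wu: "W *\<^sub>v u \<in> carrier_vec n"
    and BWu: "B *\<^sub>v (W *\<^sub>v u) \<in> carrier_vec n"
    using W B u by simp_all
  have "transpose_mat W * B * W *\<^sub>v u = transpose_mat W *\<^sub>v (B *\<^sub>v (W *\<^sub>v u))"
    by (simp only: assoc_mult_mat_vec[OF mult_carrier_mat[OF Wt B] W u] assoc_mult_mat_vec[OF Wt B Wu])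
  then have "qf (transpose_mat W * B * W) u = u \<bullet> (transpose_mat W *\<^sub>v (B *\<^sub>v (W *\<^sub>v u)))"
    by (simp only: qf_def)
  also have "\<dots> = (transpose_mat W *\<^sub>v (B *\<^sub>v (W *\<^sub>v u))) \<bullet> u"
    by (rule comm_scalar_prod[OF u mult_mat_vec_carrier[OF Wt BWu]])
  also have "\<dots> = (B *\<^sub>v (W *\<^sub>v u)) \<bullet> (W *\<^sub>v u)"
    by (rule transpose_vec_mult_scalar[OF W u BWu])
  also have "\<dots> = qf B (W *\<^sub>v u)"
    unfolding qf_def by (rule comm_scalar_prod[OF BWu Wu])
  finally show ?thesis .
qed

lemma symmetric_mat_iff:
  assumes "A \<in> carrier_mat n n"
  shows "symmetric_mat A \<longleftrightarrow> (\<forall>i<n. \<forall>j<n. A $$ (i, j) = A $$ (j, i))"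
proof
  assume "symmetric_mat A"
  then have "transpose_mat A = A" by (simp add: symmetric_mat_def)
  then show "\<forall>i<n. \<forall>j<n. A $$ (i, j) = A $$ (j, i)"
    using assms by (metis carrier_matD index_transpose_mat(1))
qed (use assms in \<open>auto simp: symmetric_mat_def intro!: eq_matI\<close>)

lemma copositive_iff:
  assumes "A \<in> carrier_mat n n" "symmetric_mat A"
  shows "copositive A \<longleftrightarrow> (\<forall>x \<in> carrier_vec n. (\<forall>i<n. 0 \<le> x $ i) \<longrightarrow> 0 \<le> qf A x)"
  using assms by (auto simp: copositive_def qf_def)

lemma symmetric_congruence:
  assumes B: "B \<in> carrier_mat n n" and W: "W \<in> carrier_mat n k" and sym: "symmetric_mat B"
  shows "symmetric_mat (transpose_mat W * B * W)"
proof -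
  have Wt: "transpose_mat W \<in> carrier_mat k n" using W by simp
  have "transpose_mat (transpose_mat W * B * W) = transpose_mat W * transpose_mat (transpose_mat W * B)"
    by (rule transpose_mult[OF mult_carrier_mat[OF Wt B] W])
  also have "transpose_mat (transpose_mat W * B) = B * W"
    using transpose_mult[OF Wt B] sym by (simp add: symmetric_mat_def)
  also have "transpose_mat W * (B * W) = transpose_mat W * B * W"
    by (rule assoc_mult_mat[OF Wt B W, symmetric])
  finally show ?thesis using W by (simp add: symmetric_mat_def)
qed

text \<open>Justifies discarding matrices in step C23.\<close>

lemma copositive_entrywise_nonneg:
  assumes "A \<in> carrier_mat n n" "symmetric_mat A" "entrywise_nonneg A"
  shows "copositive A"
  unfolding copositive_iff[OF assms(1,2)]
  using assms by (auto simp: qf_sum entrywise_nonneg_def intro!: sum_nonneg)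

text \<open>Evaluate the form at the first unit vector; the contrapositive justifies the verdict of
  step C22.\<close>

lemma copositive_corner_nonneg:
  assumes "A \<in> carrier_mat n n" "0 < n" "copositive A"
  shows "0 \<le> A $$ (0, 0)"
proof -
  have "A *\<^sub>v unit_vec n 0 = col A 0" using assms by (intro eq_vecI) auto
  then have "qf A (unit_vec n 0) = A $$ (0, 0)"
    using assms by (simp add: qf_def scalar_prod_left_unit[of _ n])
  moreover have "0 \<le> qf A (unit_vec n 0)"
    using assms copositive_iff[of A n] by (auto simp: copositive_def)
  ultimately show ?thesis by simp
qed

subsection \<open>The projection operator\<close>

lemma quadratic_nonneg_iff:
  fixes c a q :: real
  assumes "0 \<le> c"
  shows "(\<forall>t\<ge>0. 0 \<le> c * t\<^sup>2 + 2 * t * a + q) \<longleftrightarrow> 0 \<le> q \<and> (a \<le> 0 \<longrightarrow> a\<^sup>2 \<le> c * q)"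
proof
  assume *: "\<forall>t\<ge>0. 0 \<le> c * t\<^sup>2 + 2 * t * a + q"
  have q: "0 \<le> q" using *[rule_format, of 0] by simp
  have "a\<^sup>2 \<le> c * q" if a: "a \<le> 0"
  proof (cases "c = 0")
    case True
    have "a = 0"
    proof (rule ccontr)
      assume "a \<noteq> 0"
      \<comment> \<open>At this \<open>t\<close> the linear function \<open>2 * t * a + q\<close>
        takes the value -1.\<close>
      with a *[rule_format, of "(q + 1) / (- 2 * a)"] q True show False
        by (simp add: field_simps divide_nonneg_neg)
    qed
    with True show ?thesis by simp
  next
    case False
    with assms have c: "0 < c" by simp
    \<comment> \<open>The point \<open>- a / c\<close> is the vertex of the parabola, and the outer
      factor \<open>c\<close> clears the denominators.\<close>
    have "0 \<le> c * (c * (- a / c)\<^sup>2 + 2 * (- a / c) * a + q)"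
      using *[rule_format, of "- a / c"] a c by (simp add: divide_nonpos_pos)
    also have "\<dots> = c * q - a\<^sup>2"
      using c by (simp add: field_simps power2_eq_square)
    finally show ?thesis by simp
  qed
  with q show "0 \<le> q \<and> (a \<le> 0 \<longrightarrow> a\<^sup>2 \<le> c * q)" by simp
next
  assume *: "0 \<le> q \<and> (a \<le> 0 \<longrightarrow> a\<^sup>2 \<le> c * q)"
  show "\<forall>t\<ge>0. 0 \<le> c * t\<^sup>2 + 2 * t * a + q"
  proof (intro allI impI)
    fix t :: real assume t: "0 \<le> t"
    show "0 \<le> c * t\<^sup>2 + 2 * t * a + q"
    proof (cases "0 \<le> a")
      case True
      with * t assms show ?thesis by simp
    next
      case False
      with * have "0 < a\<^sup>2" "a\<^sup>2 \<le> c * q" by auto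
      \<comment> \<open>A positive square below \<open>c * q\<close> excludes
        \<open>c = 0\<close>.\<close>
      with assms * have c: "0 < c" by (cases "c = 0") auto
      have "0 \<le> (c * t + a)\<^sup>2" by simp
      \<comment> \<open>Completing the square: the two sides differ by \<open>c * q\<close> minus
        the square of \<open>a\<close>.\<close>
      also have "\<dots> \<le> c * (c * t\<^sup>2 + 2 * t * a + q)"
        using \<open>a\<^sup>2 \<le> c * q\<close> by (simp add: power2_eq_square algebra_simps)
      finally show ?thesis using c by (simp add: zero_le_mult_iff)
    qed
  qed
qed

section \<open>Scaling, and the forms of the blocks\<close>

definition dscale :: "real mat \<Rightarrow> nat \<Rightarrow> real" where
  "dscale A i = (if A $$ (0, Suc i) = 0 then 1 else 1 / \<bar>A $$ (0, Suc i)\<bar>)"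

lemma dscale_pos: "0 < dscale A i"
  by (simp add: dscale_def)

text \<open>This is the purpose of the scaling: it turns the first row into its sign vector, so the
  half-space condition becomes a comparison of two coordinate sums.\<close>

lemma sgn_eq_mult_dscale: "sgn (A $$ (0, Suc i)) = A $$ (0, Suc i) * dscale A i"
  by (simp add: dscale_def sgn_real_def)

context
  fixes A :: "real mat" and m :: nat
  assumes A: "A \<in> carrier_mat (Suc m) (Suc m)" and sym: "symmetric_mat A"
begin

lemma carriers:
  "trailing_block A \<in> carrier_mat m m" "scaling_mat A \<in> carrier_mat m m"
  "scaled_block A \<in> carrier_mat m m" "B_mat A \<in> carrier_mat m m" "sign_vec A \<in> carrier_vec m"
  using A by (auto simp: trailing_block_def scaling_mat_def scaled_block_def B_mat_def
      sign_vec_def alpha_vec_def mat_diag_def)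

lemma sign_vec_index: "i < m \<Longrightarrow> sign_vec A $ i = sgn (A $$ (0, Suc i))"
  using A by (simp add: sign_vec_def alpha_vec_def)

lemma scaled_block_index:
  assumes "i < m" "j < m"
  shows "scaled_block A $$ (i, j) = dscale A i * A $$ (Suc i, Suc j) * dscale A j"
proof -
  have D: "scaling_mat A = mat_diag m (dscale A)"
    using A by (auto simp: scaling_mat_def mat_diag_def dscale_def alpha_vec_def intro!: eq_matI)
  show ?thesis
    using assms A carriers(1)
    by (simp add: scaled_block_def D mat_diag_mult_left[of _ m m] mat_diag_mult_right[of _ m m]
        trailing_block_def)
qed

lemma B_mat_index:
  assumes "i < m" "j < m"
  shows "B_mat A $$ (i, j) = A $$ (0, 0) * scaled_block A $$ (i, j)
    - sgn (A $$ (0, Suc i)) * sgn (A $$ (0, Suc j))"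
  using assms A carriers(3) by (simp add: B_mat_def sign_vec_index)

lemma A_index_sym: "i \<le> m \<Longrightarrow> j \<le> m \<Longrightarrow> A $$ (i, j) = A $$ (j, i)"
  using sym symmetric_mat_iff[OF A] by auto

lemma symmetric_scaled_block: "symmetric_mat (scaled_block A)"
  unfolding symmetric_mat_iff[OF carriers(3)]
  using A_index_sym by (auto simp: scaled_block_index)

lemma symmetric_B_mat: "symmetric_mat (B_mat A)"
  unfolding symmetric_mat_iff[OF carriers(4)]
  using A_index_sym by (auto simp: B_mat_index scaled_block_index)

text \<open>The form \<open>Q\<close> of the trailing block. It takes functions instead of vectors,
  so that passing to the tail of a vector and rescaling coordinates are plain abstractions.\<close>

definition tail_qf :: "(nat \<Rightarrow> real) \<Rightarrow> real" where
  "tail_qf y = (\<Sum>i<m. \<Sum>j<m. y i * A $$ (Suc i, Suc j) * y j)"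

definition alpha_dot :: "(nat \<Rightarrow> real) \<Rightarrow> real" where
  "alpha_dot y = (\<Sum>i<m. A $$ (0, Suc i) * y i)"

lemma qf_split:
  assumes "x \<in> carrier_vec (Suc m)"
  shows "qf A x = A $$ (0, 0) * (x $ 0)\<^sup>2 + 2 * x $ 0 * alpha_dot (\<lambda>i. x $ Suc i)
    + tail_qf (\<lambda>i. x $ Suc i)"
proof -
  have "A $$ (Suc i, 0) = A $$ (0, Suc i)" if "i < m" for i
    using A_index_sym that by auto
  then show ?thesis
    using A assms
    by (simp add: qf_sum tail_qf_def alpha_dot_def sum.lessThan_Suc_shift sum.distrib
        sum_distrib_left power2_eq_square algebra_simps del: sum.lessThan_Suc)
qed

lemma qf_scaled_block:
  assumes "z \<in> carrier_vec m"
  shows "qf (scaled_block A) z = tail_qf (\<lambda>i. dscale A i * z $ i)"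
  using assms by (simp add: qf_sum[OF carriers(3)] tail_qf_def scaled_block_index algebra_simps)

lemma alpha_dot_dscale:
  "alpha_dot (\<lambda>i. dscale A i * z i) = (\<Sum>i<m. sgn (A $$ (0, Suc i)) * z i)"
  by (simp add: alpha_dot_def sgn_eq_mult_dscale mult.assoc)

text \<open>With \<open>y = D z\<close>, nonnegativity of this form is the second condition of
  \<open>quadratic_nonneg_iff\<close>; the rank-one part of \<open>B_mat A\<close> supplies the
  square.\<close>

lemma qf_B_mat:
  assumes "z \<in> carrier_vec m"
  shows "qf (B_mat A) z = A $$ (0, 0) * tail_qf (\<lambda>i. dscale A i * z $ i)
    - (alpha_dot (\<lambda>i. dscale A i * z $ i))\<^sup>2"
proof -
  have "qf (B_mat A) z = (\<Sum>i<m. \<Sum>j<m. A $$ (0, 0) * (z $ i * scaled_block A $$ (i, j) * z $ j)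
      - (sgn (A $$ (0, Suc i)) * z $ i) * (sgn (A $$ (0, Suc j)) * z $ j))"
    unfolding qf_sum[OF carriers(4) assms]
    by (intro sum.cong refl) (simp add: B_mat_index algebra_simps)
  also have "\<dots> = A $$ (0, 0) * qf (scaled_block A) z
      - (\<Sum>i<m. sgn (A $$ (0, Suc i)) * z $ i)\<^sup>2"
    unfolding qf_sum[OF carriers(3) assms] power2_eq_square sum_product
    by (simp add: sum_subtractf sum_distrib_left)
  finally show ?thesis using assms by (simp add: qf_scaled_block alpha_dot_dscale)
qed

section \<open>Copositivity in terms of the smaller blocks\<close>

lemma copositive_iff_tail:
  assumes "0 \<le> A $$ (0, 0)"
  shows "copositive A \<longleftrightarrow> (\<forall>y. (\<forall>i<m. 0 \<le> y i) \<longrightarrow>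
    0 \<le> tail_qf y \<and> (alpha_dot y \<le> 0 \<longrightarrow> (alpha_dot y)\<^sup>2 \<le> A $$ (0, 0) * tail_qf y))"
proof -
  have "copositive A \<longleftrightarrow> (\<forall>y. (\<forall>i<m. 0 \<le> y i) \<longrightarrow>
    (\<forall>t\<ge>0. 0 \<le> A $$ (0, 0) * t\<^sup>2 + 2 * t * alpha_dot y + tail_qf y))" (is "_ \<longleftrightarrow> ?R")
  proof
    assume cop: "copositive A"
    show ?R
    proof (intro allI impI)
      fix y :: "nat \<Rightarrow> real" and t :: real assume y: "\<forall>i<m. 0 \<le> y i" and t: "0 \<le> t"
      \<comment> \<open>\<open>case_nat\<close> prepends \<open>t\<close> to \<open>y\<close>, so a
        vector of the larger orthant is a pair of a first coordinate and a tail.\<close>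
      define x where "x = vec (Suc m) (case_nat t y)"
      have x: "x \<in> carrier_vec (Suc m)" "\<forall>i<Suc m. 0 \<le> x $ i"
        using y t by (auto simp: x_def split: nat.split)
      have "alpha_dot (\<lambda>i. x $ Suc i) = alpha_dot y" "tail_qf (\<lambda>i. x $ Suc i) = tail_qf y" "x $ 0 = t"
        by (auto simp: alpha_dot_def tail_qf_def x_def)
      then show "0 \<le> A $$ (0, 0) * t\<^sup>2 + 2 * t * alpha_dot y + tail_qf y"
        using cop x qf_split[OF x(1)] copositive_iff[OF A sym] by metis
    qed
  next
    assume ?R
    then show "copositive A"
      by (auto simp: copositive_iff[OF A sym] qf_split)
  qed
  then show ?thesis using quadratic_nonneg_iff[OF assms] by simp
qed

text \<open>A positive diagonal scaling is a bijection of the orthant. The congruence assumption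
  bridges functions on all naturals and vectors, which know only the indices below
  \<open>m\<close>.\<close>

lemma all_nonneg_dscale:
  fixes P :: "(nat \<Rightarrow> real) \<Rightarrow> bool"
  assumes cong: "\<And>y y'. (\<And>i. i < m \<Longrightarrow> y i = y' i) \<Longrightarrow> P y = P y'"
  shows "(\<forall>y. (\<forall>i<m. 0 \<le> y i) \<longrightarrow> P y) \<longleftrightarrow>
    (\<forall>z \<in> carrier_vec m. (\<forall>i<m. 0 \<le> z $ i) \<longrightarrow> P (\<lambda>i. dscale A i * z $ i))"
proof (intro iffI ballI allI impI)
  fix z :: "real vec" assume "\<forall>y. (\<forall>i<m. 0 \<le> y i) \<longrightarrow> P y" "\<forall>i<m. 0 \<le> z $ i"
  then show "P (\<lambda>i. dscale A i * z $ i)"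
    by (simp add: dscale_pos less_imp_le)
next
  fix y :: "nat \<Rightarrow> real"
  assume *: "\<forall>z \<in> carrier_vec m. (\<forall>i<m. 0 \<le> z $ i) \<longrightarrow> P (\<lambda>i. dscale A i * z $ i)"
    and y: "\<forall>i<m. 0 \<le> y i"
  let ?z = "vec m (\<lambda>i. y i / dscale A i)"
  have "P (\<lambda>i. dscale A i * ?z $ i)"
    using y by (intro *[rule_format]) (auto simp: dscale_pos less_imp_le)
  moreover have "dscale A i * ?z $ i = y i" if "i < m" for i
    using that dscale_pos[of A i] by simp
  ultimately show "P y" using cong[of "\<lambda>i. dscale A i * ?z $ i" y] by simp
qed

lemma copositive_iff_scaled:
  assumes "0 \<le> A $$ (0, 0)"
  shows "copositive A \<longleftrightarrow> copositive (scaled_block A) \<and>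
    (\<forall>z \<in> carrier_vec m. (\<forall>i<m. 0 \<le> z $ i) \<longrightarrow> (\<Sum>i<m. sgn (A $$ (0, Suc i)) * z $ i) \<le> 0
      \<longrightarrow> 0 \<le> qf (B_mat A) z)"
proof -
  define P where "P y \<longleftrightarrow> 0 \<le> tail_qf y \<and>
    (alpha_dot y \<le> 0 \<longrightarrow> (alpha_dot y)\<^sup>2 \<le> A $$ (0, 0) * tail_qf y)" for y
  have "tail_qf y = tail_qf y'" "alpha_dot y = alpha_dot y'"
    if "\<And>i. i < m \<Longrightarrow> y i = y' i" for y y'
    using that by (auto simp: tail_qf_def alpha_dot_def)
  then have cong: "P y = P y'" if "\<And>i. i < m \<Longrightarrow> y i = y' i" for y y'
    using that unfolding P_def by metis
  have P_dscale: "P (\<lambda>i. dscale A i * z $ i) \<longleftrightarrow> 0 \<le> qf (scaled_block A) z \<and>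
      ((\<Sum>i<m. sgn (A $$ (0, Suc i)) * z $ i) \<le> 0 \<longrightarrow> 0 \<le> qf (B_mat A) z)"
    if "z \<in> carrier_vec m" for z
    unfolding P_def qf_scaled_block[OF that] qf_B_mat[OF that] alpha_dot_dscale diff_ge_0_iff_ge ..
  have "copositive A \<longleftrightarrow> (\<forall>y. (\<forall>i<m. 0 \<le> y i) \<longrightarrow> P y)"
    unfolding P_def by (rule copositive_iff_tail[OF assms])
  also have "\<dots> \<longleftrightarrow> (\<forall>z \<in> carrier_vec m. (\<forall>i<m. 0 \<le> z $ i) \<longrightarrow> P (\<lambda>i. dscale A i * z $ i))"
    by (rule all_nonneg_dscale[OF cong])
  finally show ?thesis
    unfolding copositive_iff[OF carriers(3) symmetric_scaled_block] using P_dscale by blast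
qed

text \<open>By \<open>copositive_iff_scaled\<close> it remains to test \<open>B_mat A\<close> where
  the signed coordinate sum is nonpositive. If some sign is negative, this region is the union of
  the cones over the columns of the \<open>W\<close>, and the substitution \<open>z = W u\<close>
  with nonnegative \<open>u\<close> turns the test into copositivity of the congruent
  matrices.\<close>

lemma Proj_sound:
  assumes P: "is_Proj A P" and corner: "0 \<le> A $$ (0, 0)"
  shows "(\<forall>L \<in> P. L \<in> carrier_mat m m \<and> symmetric_mat L) \<and>
    (copositive A \<longleftrightarrow> (\<forall>L \<in> P. copositive L))"
  using P
proof cases
  case (no_negative_sign n)
  have n: "n = Suc m" using A no_negative_sign by auto
  \<comment> \<open>Without negative signs the signed sum must vanish on the region, and the form of
    \<open>B_mat A\<close> reduces to the corner times that of
    \<open>scaled_block A\<close>.\<close>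
  have "0 \<le> qf (B_mat A) z"
    if z: "z \<in> carrier_vec m" "\<forall>i<m. 0 \<le> z $ i" "(\<Sum>i<m. sgn (A $$ (0, Suc i)) * z $ i) \<le> 0"
      and cop: "copositive (scaled_block A)" for z
  proof -
    have "0 \<le> (\<Sum>i<m. sgn (A $$ (0, Suc i)) * z $ i)"
      using no_negative_sign n z by (intro sum_nonneg) (auto simp: sign_vec_index)
    then have "(\<Sum>i<m. sgn (A $$ (0, Suc i)) * z $ i) = 0" using z by linarith
    moreover have "0 \<le> qf (scaled_block A) z"
      using cop z by (simp add: copositive_iff[OF carriers(3) symmetric_scaled_block])
    ultimately show ?thesis
      using corner z by (simp add: qf_B_mat alpha_dot_dscale qf_scaled_block)
  qed
  then show ?thesis
    using no_negative_sign copositive_iff_scaled[OF corner] carriers(3) symmetric_scaled_block by auto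
next
  case (negative_sign n as bs cs Ws)
  have n: "n - 1 = m" using A negative_sign by auto
  let ?s = "\<lambda>i. sgn (A $$ (0, Suc i))"
  have idx: "{i. i < m \<and> sign_vec A $ i = c} = {i. i < m \<and> ?s i = c}" for c
    by (auto simp: sign_vec_index)
  have as: "distinct as" "set as = {i. i < m \<and> ?s i = 1}"
    and bs: "distinct bs" "set bs = {i. i < m \<and> ?s i = -1}"
    and cs: "distinct cs" "set cs = {i. i < m \<and> ?s i = 0}"
    using negative_sign(6-8) unfolding n enumerates_def idx by blast+
  obtain k where "k < m" "sign_vec A $ k = -1"
    using negative_sign(5) unfolding n by blast
  then have "k \<in> set bs"
    using bs(2) sign_vec_index by simp
  then have bs_ne: "bs \<noteq> []"
    by (metis empty_iff list.set(1))
  have Ws: "list_all2 (is_W m cs) (Vmatrix m as bs) Ws"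
    using negative_sign(9) unfolding n .
  have s_values: "\<forall>i<m. ?s i \<in> {-1, 0, 1}" by (auto simp: sgn_real_def)
  have W_set: "set (cols W) = unit_vec m ` set cs \<union> set S" if "is_W m cs S W" for S W
    using that unfolding is_W_def by (metis mset_eq_setD set_append set_map)
  have W_carrier: "W \<in> carrier_mat m m" if "W \<in> set Ws" for W
    using Ws that by (auto simp: list_all2_conv_all_nth in_set_conv_nth is_W_def)
  have L_carrier: "transpose_mat W * B_mat A * W \<in> carrier_mat m m" if "W \<in> set Ws" for W
    using W_carrier[OF that] carriers(4) by (metis mult_carrier_mat transpose_carrier_mat)
  have L_symmetric: "symmetric_mat (transpose_mat W * B_mat A * W)" if "W \<in> set Ws" for W
    using symmetric_congruence[OF carriers(4) W_carrier[OF that] symmetric_B_mat] .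
  have "(\<forall>z \<in> carrier_vec m. (\<forall>i<m. 0 \<le> z $ i) \<longrightarrow> (\<Sum>i<m. ?s i * z $ i) \<le> 0
      \<longrightarrow> 0 \<le> qf (B_mat A) z) \<longleftrightarrow>
    (\<forall>W \<in> set Ws. copositive (transpose_mat W * B_mat A * W))" (is "?L \<longleftrightarrow> ?R")
  proof
    assume L: ?L
    show ?R
    proof
      fix W assume W: "W \<in> set Ws"
      then obtain S where S: "S \<in> set (Vmatrix m as bs)" "is_W m cs S W"
        using Ws by (metis list_all2_conv_all_nth in_set_conv_nth)
      note Wc = W_carrier[OF W]
      \<comment> \<open>Every column lies in the region: unit vectors occur only at signs 0 and -1,
        and a midpoint joins signs 1 and -1, which cancel.\<close>
      have col: "(\<forall>i<m. 0 \<le> v $ i) \<and> (\<Sum>i<m. ?s i * v $ i) \<le> 0" if "v \<in> set (cols W)" for v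
      proof -
        have sum_unit: "(\<Sum>i<m. ?s i * unit_vec m k $ i) = ?s k" if "k < m" for k
          using that by (subst sum.remove[of _ k]) (auto intro: sum.neutral)
        have "v \<in> unit_vec m ` set cs \<union> (unit_vec m ` set bs
            \<union> {midpoint_vec m a b | a b. a \<in> set as \<and> b \<in> set bs})"
          using that W_set[OF S(2)] Vmatrix_vertices[OF S(1)] by blast
        then consider k where "v = unit_vec m k" "k < m" "?s k \<le> 0"
          | a b where "v = midpoint_vec m a b" "a < m" "b < m" "?s a = 1" "?s b = -1"
          using as(2) bs(2) cs(2) by (auto simp del: sgn_le_0_iff)
        then show ?thesis
        proof cases
          case 1
          then show ?thesis by (simp add: sum_unit del: index_unit_vec) simp
        next
          case 2
          have "(\<Sum>i<m. ?s i * v $ i)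
              = (\<Sum>i<m. (?s i * unit_vec m a $ i + ?s i * unit_vec m b $ i) / 2)"
            using 2 by (intro sum.cong refl) (simp add: midpoint_vec_def distrib_left
                del: index_unit_vec(1))
          also have "\<dots>
              = ((\<Sum>i<m. ?s i * unit_vec m a $ i) + (\<Sum>i<m. ?s i * unit_vec m b $ i)) / 2"
            by (simp only: sum_divide_distrib[symmetric] sum.distrib)
          also have "\<dots> = 0" using 2 by (simp only: sum_unit) simp
          finally show ?thesis using 2 by (simp add: midpoint_vec_def)
        qed
      qed
      have "0 \<le> qf (transpose_mat W * B_mat A * W) u"
        if u: "u \<in> carrier_vec m" "\<forall>i<m. 0 \<le> u $ i" for u
      proof -
        have Wij: "0 \<le> W $$ (i, j)" if "i < m" "j < m" for i j
          using col[of "col W j"] that Wc by (auto simp: cols_def)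
        have Wu: "(W *\<^sub>v u) $ i = (\<Sum>j<m. W $$ (i, j) * u $ j)" if "i < m" for i
          using that Wc u by (simp add: scalar_prod_def atLeast0LessThan)
        have "(\<Sum>i<m. ?s i * (W *\<^sub>v u) $ i) = (\<Sum>i<m. \<Sum>j<m. ?s i * W $$ (i, j) * u $ j)"
          by (simp add: Wu sum_distrib_left mult.assoc)
        \<comment> \<open>Swapping the sums exhibits a nonnegative combination of the signed sums of
          the columns.\<close>
        also have "\<dots> = (\<Sum>j<m. (\<Sum>i<m. ?s i * col W j $ i) * u $ j)"
          using Wc by (subst sum.swap) (simp add: sum_distrib_right)
        also have "\<dots> \<le> 0"
        proof (rule sum_nonpos)
          fix j assume "j \<in> {..<m}"
          then have "col W j \<in> set (cols W)" "0 \<le> u $ j"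
            using Wc u by (auto simp: cols_def)
          then show "(\<Sum>i<m. ?s i * col W j $ i) * u $ j \<le> 0"
            using col by (intro mult_nonpos_nonneg) blast+
        qed
        finally have "(\<Sum>i<m. ?s i * (W *\<^sub>v u) $ i) \<le> 0" .
        moreover have "\<forall>i<m. 0 \<le> (W *\<^sub>v u) $ i"
          using u by (auto simp: Wu Wij intro!: sum_nonneg)
        moreover have "W *\<^sub>v u \<in> carrier_vec m" using Wc u by auto
        ultimately show ?thesis
          using L qf_congruence[OF carriers(4) Wc u(1)] by simp
      qed
      then show "copositive (transpose_mat W * B_mat A * W)"
        using copositive_iff[OF L_carrier[OF W] L_symmetric[OF W]] by blast
    qed
  next
    assume R: ?R
    show ?L
    proof (intro ballI impI)
      fix z assume z: "z \<in> carrier_vec m" "\<forall>i<m. 0 \<le> z $ i" "(\<Sum>i<m. ?s i * z $ i) \<le> 0"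
      \<comment> \<open>Coordinates of sign zero do not affect the signed sum. They are set aside to
        apply \<open>Vmatrix_covers\<close> and restored afterwards by the unit vectors at
        \<open>cs\<close>.\<close>
      define y where "y = vec m (\<lambda>i. if i \<in> set cs then 0 else z $ i)"
      have "map (($) y) as = map (($) z) as" "map (($) y) bs = map (($) z) bs"
        using as bs cs by (auto simp: y_def)
      moreover have "sum_list (map (($) z) as) \<le> sum_list (map (($) z) bs)"
        using z(3) as bs s_values
        by (subst (asm) sum_sign_partition[of as m ?s bs]) (auto simp: enumerates_def)
      ultimately have "\<exists>S \<in> set (Vmatrix m as bs). in_cone m (set S) y"
        using z as bs cs bs_ne s_values
        by (intro Vmatrix_covers) (auto simp: y_def simp del: map_eq_conv)
      then obtain S where S: "S \<in> set (Vmatrix m as bs)" "in_cone m (set S) y" by blast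
      then obtain W where W: "W \<in> set Ws" "is_W m cs S W"
        using Ws by (metis list_all2_conv_all_nth in_set_conv_nth)
      note Wc = W_carrier[OF W(1)]
      have "in_cone m (set S \<union> unit_vec m ` set cs) z"
        using S(2) z cs unfolding y_def by (intro in_cone_add_units) auto
      then have "in_cone m (set (cols W)) z"
        by (simp add: W_set[OF W(2)] Un_commute)
      then obtain u where u: "u \<in> carrier_vec m" "\<forall>i<m. 0 \<le> u $ i" "z = W *\<^sub>v u"
        using in_cone_imp_mult_mat_vec[OF Wc] by blast
      have "0 \<le> qf (transpose_mat W * B_mat A * W) u"
        using R W(1) u(1,2) copositive_iff[OF L_carrier L_symmetric] by blast
      then show "0 \<le> qf (B_mat A) z"
        using qf_congruence[OF carriers(4) Wc u(1)] u(3) by simp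
    qed
  qed
  then have "copositive A \<longleftrightarrow> (\<forall>L \<in> P. copositive L)"
    unfolding copositive_iff_scaled[OF corner] negative_sign(1) by blast
  moreover have "\<forall>L \<in> P. L \<in> carrier_mat m m \<and> symmetric_mat L"
    using L_carrier L_symmetric carriers(3) symmetric_scaled_block
    unfolding negative_sign(1) by blast
  ultimately show ?thesis by blast
qed

text \<open>Guarantees that step C23 can be carried out. The point to check is that each
  \<open>W\<close> can be square: the three sign classes partition the \<open>m\<close> indices, and
  each simplex has as many vertices as there are nonzero signs.\<close>

lemma Proj_exists:
  assumes "0 < m"
  shows "\<exists>P. is_Proj A P"
proof (cases "\<forall>i < m. 0 \<le> sign_vec A $ i")
  case True
  then have "is_Proj A {scaled_block A}"
    using A sym assms by (intro is_Proj.no_negative_sign[of A "Suc m"]) simp_all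
  then show ?thesis by blast
next
  case False
  then obtain k where "k < m" "sign_vec A $ k < 0"
    by (auto simp: not_le)
  then have k: "k < m" "sign_vec A $ k = -1"
    by (simp_all add: sign_vec_index sgn_if split: if_splits)
  have ex: "\<exists>xs. enumerates xs {i. i < m \<and> Q i}" for Q
    using finite_distinct_list[of "{i. i < m \<and> Q i}"] by (auto simp: enumerates_def)
  obtain as bs cs where
    as: "enumerates as {i. i < m \<and> sign_vec A $ i = 1}" and
    bs: "enumerates bs {i. i < m \<and> sign_vec A $ i = -1}" and
    cs: "enumerates cs {i. i < m \<and> sign_vec A $ i = 0}"
    using ex by meson
  have sets: "set as = {i. i < m \<and> sign_vec A $ i = 1}" "set bs = {i. i < m \<and> sign_vec A $ i = -1}"
    "set cs = {i. i < m \<and> sign_vec A $ i = 0}"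
    using as bs cs by (simp_all add: enumerates_def)
  have "sign_vec A $ i = -1 \<or> sign_vec A $ i = 0 \<or> sign_vec A $ i = 1" if "i < m" for i
    by (simp add: sign_vec_index[OF that] sgn_if)
  then have "set (cs @ as @ bs) = {..<m}"
    unfolding set_append sets by blast
  moreover have "distinct (cs @ as @ bs)"
    using as bs cs sets by (simp add: enumerates_def disjoint_iff)
  ultimately have "length (cs @ as @ bs) = m"
    by (metis distinct_card card_lessThan)
  then have len: "length cs + (length as + length bs) = m" by simp
  define Ws where "Ws = map (\<lambda>S. mat_of_cols m (map (unit_vec m) cs @ S)) (Vmatrix m as bs)"
  have "is_W m cs S (mat_of_cols m (map (unit_vec m) cs @ S))" if "S \<in> set (Vmatrix m as bs)" for S
  proof -
    have "set (map (unit_vec m) cs @ S) \<subseteq> carrier_vec m"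
      using Vmatrix_vertices[OF that] by (fastforce simp: midpoint_vec_def)
    then have "cols (mat_of_cols m (map (unit_vec m) cs @ S)) = map (unit_vec m) cs @ S"
      by (rule cols_mat_of_cols)
    then show ?thesis
      using length_Vmatrix[OF that] len by (simp add: is_W_def carrier_matI)
  qed
  then have "list_all2 (is_W m cs) (Vmatrix m as bs) Ws"
    by (auto simp: Ws_def list_all2_conv_all_nth)
  moreover have "\<exists>i < m. sign_vec A $ i = -1" using k by blast
  ultimately have "is_Proj A (insert (scaled_block A) {transpose_mat W * B_mat A * W | W. W \<in> set Ws})"
    using A sym assms as bs cs by (intro is_Proj.negative_sign[of A "Suc m" as bs cs Ws]) simp_all
  then show ?thesis by blast
qed

end

subsection \<open>Executions\<close>

text \<open>The loop invariant. All matrices share one order, and the clause for order one encodes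
  the convention on such matrices: a nonempty set of them triggers C22, so Proj is never applied to
  them.\<close>

definition good :: "nat \<Rightarrow> real mat set \<Rightarrow> bool" where
  "good m F \<longleftrightarrow> 0 < m \<and> (\<forall>K \<in> F. K \<in> carrier_mat m m \<and> symmetric_mat K \<and>
     (m = 1 \<longrightarrow> K $$ (0, 0) < 0))"

definition verdict_of :: "real mat set \<Rightarrow> verdict" where
  "verdict_of F = (if \<forall>K \<in> F. copositive K then Is_Copositive else Is_Not_Copositive)"

lemma good_step:
  assumes good: "good m F" and step: "copomatrix_step (Running F) s"
  shows "s = Returned (verdict_of F) \<or>
    (\<exists>k F'. m = Suc k \<and> s = Running F' \<and> good k F' \<and> verdict_of F' = verdict_of F)"
  using step
proof cases
  case C21
  then show ?thesis by (simp add: verdict_of_def)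
next
  case C22
  then obtain K where "K \<in> F" "K $$ (0, 0) < 0" by blast
  then have "\<not> copositive K"
    using copositive_corner_nonneg[of K m] good by (auto simp: good_def)
  with \<open>K \<in> F\<close> C22 show ?thesis by (auto simp: verdict_of_def)
next
  case (C23 Pr P)
  have "m \<noteq> 1" using C23 good by (auto simp: good_def)
  then obtain k where k: "m = Suc k" "0 < k" using good by (cases m) (auto simp: good_def)
  have sound: "(\<forall>L \<in> Pr K. L \<in> carrier_mat k k \<and> symmetric_mat L) \<and>
    (copositive K \<longleftrightarrow> (\<forall>L \<in> Pr K. copositive L))" if "K \<in> F" for K
    using that C23 good k by (intro Proj_sound) (auto simp: good_def not_less)
  let ?F = "P - {K \<in> P. entrywise_nonneg K}"
  have P: "L \<in> carrier_mat k k \<and> symmetric_mat L" if "L \<in> P" for L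
    using that sound C23(5) by blast
  have "good k ?F"
    \<comment> \<open>A matrix of order one that survives the filter has its only entry
      negative.\<close>
    using P k(2) by (fastforce simp: good_def entrywise_nonneg_def not_le)
  moreover have "(\<forall>L \<in> ?F. copositive L) \<longleftrightarrow> (\<forall>L \<in> P. copositive L)"
    using P copositive_entrywise_nonneg[of _ k] by blast
  moreover have "(\<forall>L \<in> P. copositive L) \<longleftrightarrow> (\<forall>K \<in> F. copositive K)"
    using sound C23(5) by blast
  ultimately show ?thesis using k(1) C23(1) unfolding verdict_of_def by simp
qed

section \<open>Progress, termination and the returned verdict\<close>

lemma good_progress:
  assumes "good m F"
  shows "\<exists>s. copomatrix_step (Running F) s"
proof (cases "F = {} \<or> (\<exists>K \<in> F. K $$ (0, 0) < 0)")
  case True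
  then show ?thesis using C21 C22 by auto
next
  case False
  then have "m \<noteq> 1" using assms by (auto simp: good_def)
  then obtain k where k: "m = Suc k" "0 < k" using assms by (cases m) (auto simp: good_def)
  have "\<forall>K \<in> F. \<exists>P. is_Proj K P"
    using Proj_exists[of _ k] assms k by (auto simp: good_def)
  then obtain Pr where "\<forall>K \<in> F. is_Proj K (Pr K)" by metis
  then show ?thesis using C23[of F Pr] False by auto
qed

lemma Returned_no_step: "\<not> copomatrix_step (Returned v) s"
  by (auto elim: copomatrix_step.cases)

lemma good_no_infinite_run:
  assumes "good m F" "\<sigma> 0 = Running F" "\<forall>k::nat. copomatrix_step (\<sigma> k) (\<sigma> (Suc k))"
  shows False
  using assms
proof (induction m arbitrary: F \<sigma>)
  case 0
  then show ?case by (simp add: good_def)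
next
  case (Suc m)
  \<comment> \<open>The second step shows that the run has not returned after the first one, so the
    order has dropped and the shifted run falls under the induction hypothesis.\<close>
  have "copomatrix_step (Running F) (\<sigma> 1)" "copomatrix_step (\<sigma> 1) (\<sigma> 2)"
    using Suc.prems(2) Suc.prems(3)[rule_format, of 0] Suc.prems(3)[rule_format, of 1]
    by (auto simp: numeral_2_eq_2)
  then obtain F' where "\<sigma> 1 = Running F'" "good m F'"
    using good_step[OF Suc.prems(1)] Returned_no_step by (metis nat.inject)
  then show ?case using Suc.IH[of F' "\<lambda>k. \<sigma> (Suc k)"] Suc.prems(3) by simp
qed

lemma good_returns:
  assumes "good m F"
  shows "copomatrix_step\<^sup>*\<^sup>* (Running F) (Returned (verdict_of F))"
  using assms
proof (induction m arbitrary: F)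
  case 0
  then show ?case by (simp add: good_def)
next
  case (Suc m)
  obtain s where s: "copomatrix_step (Running F) s" using good_progress[OF Suc.prems] by blast
  from good_step[OF Suc.prems s] have "copomatrix_step\<^sup>*\<^sup>* s (Returned (verdict_of F))"
  proof (elim disjE exE conjE)
    fix k F' assume "Suc m = Suc k" "s = Running F'" "good k F'" "verdict_of F' = verdict_of F"
    then show ?thesis using Suc.IH[of F'] by simp
  qed simp
  with s show ?case by (rule converse_rtranclp_into_rtranclp)
qed

text \<open>The invariant and the verdict persist along every execution. Since running states can
  always proceed by \<open>good_progress\<close>, an execution can end only in this verdict.\<close>

lemma good_reachable:
  assumes "copomatrix_step\<^sup>*\<^sup>* (Running F) s" "good m F"
  shows "s = Returned (verdict_of F) \<or>
    (\<exists>k F'. s = Running F' \<and> good k F' \<and> verdict_of F' = verdict_of F)"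
  using assms
proof (induction rule: rtranclp_induct)
  case base
  then show ?case by blast
next
  case (step s s')
  then show ?case using good_step Returned_no_step by metis
qed

lemma good_outputs:
  assumes "good n {A}"
  shows "copomatrix_outputs A (verdict_of {A})"
  unfolding copomatrix_outputs_def
  using good_returns[OF assms] good_reachable[OF _ assms] good_progress by blast

theorem mainTheorem2:
  fixes n :: nat and A :: "real mat"
  assumes "2 \<le> n" and "A \<in> carrier_mat n n" and "symmetric_mat A"
  shows "copomatrix_terminates A \<and>
    (copositive A \<longrightarrow> copomatrix_outputs A Is_Copositive) \<and>
    (\<not> copositive A \<longrightarrow> copomatrix_outputs A Is_Not_Copositive)"
proof -
  have good: "good n {A}" using assms by (simp add: good_def)
  have "copomatrix_terminates A"
    unfolding copomatrix_terminates_def using good_no_infinite_run[OF good] by blast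
  with good_outputs[OF good] show ?thesis by (simp add: verdict_of_def split: if_splits)
qed

end
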